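(* Let $k, m, n$ be positive integers. The number of primitive arrays of dimension $m \times n$ over a $k$-letter alphabet equals $$\psi_k(m,n) = \sum_{d_1 \mid m}\ \sum_{d_2 \mid n} \mu(d_1)\mu(d_2)\, k^{mn/(d_1 d_2)},$$ where $\mu$ is the Möbius function.
   Context: For an $m\times n$ array $A$ over an alphabet and positive integers $p,q$, $A^{p\times q}$ is the $pm \times qn$ array $B$ with $B[i,j] = A[i \bmod m, j \bmod n]$ (indices from $0$). A nonempty array $M$ is primitive if whenever $M = A^{p\times q}$ for some array $A$ and positive integers $p,q$, we have $p = q = 1$. The Möbius function is $\mu(n) = (-1)^t$ if $n$ is squarefree with $t$ distinct prime factors, and $\mu(n)=0$ otherwise. *)

theory Defs
  imports "Jordan_Normal_Form.Matrix" "HOL-Computational_Algebra.Squarefree"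
begin

text \<open>Arrays are elements of the matrix type \<^typ>\<open>'a mat\<close>, which puts no class
  constraint on the letters \<^typ>\<open>'a\<close> and indexes rows and columns from \<open>0\<close>.\<close>

definition array_power :: "'a mat \<Rightarrow> nat \<Rightarrow> nat \<Rightarrow> 'a mat" where
  "array_power A p q =
     mat (p * dim_row A) (q * dim_col A)
       (\<lambda>(i, j). A $$ (i mod dim_row A, j mod dim_col A))"

definition primitive_array :: "'a mat \<Rightarrow> bool" where
  "primitive_array M \<longleftrightarrow>
     dim_row M > 0 \<and> dim_col M > 0 \<and>
     (\<forall>A p q. p > 0 \<longrightarrow> q > 0 \<longrightarrow> M = array_power A p q \<longrightarrow> p = 1 \<and> q = 1)"

definition moebius_mu :: "nat \<Rightarrow> int" where
  "moebius_mu n = (if squarefree n then (-1) ^ card (prime_factors n) else 0)"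

end

theory Submission
  imports Defs
begin

text \<open>Extend an \<open>m \<times> n\<close> array \<open>M\<close> doubly periodically to all of \<open>\<nat> \<times> \<nat>\<close>. Then \<open>M\<close> is a
  \<open>p \<times> q\<close> power iff \<open>m / p\<close> is a period of the rows and \<open>n / q\<close> a period of the columns. The
  periods of a periodic sequence are the multiples of the least one, so the admissible \<open>p\<close> are
  exactly the divisors of some \<open>D\<close>, and the sum of \<open>\<mu> p\<close> over them is \<open>1\<close> if \<open>D = 1\<close> and \<open>0\<close>
  otherwise. Hence the product of the sum over \<open>p\<close> and the sum over \<open>q\<close> is the indicator of
  primitivity. Now sum over all \<open>M\<close> and exchange the sums; there are \<open>k ^ ((m / p) * (n / q))\<close>
  arrays that are \<open>p \<times> q\<close> powers.\<close>

section \<open>The divisor sum of the Moebius function\<close>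

text \<open>A new prime factor neither creates nor destroys squarefreeness and raises the number of
  distinct primes by one; if \<open>d\<close> is not squarefree, both sides are 0.\<close>

lemma moebius_mu_prime_mult:
  assumes "prime p" "\<not> p dvd d"
  shows "moebius_mu (p * d) = - moebius_mu d"
proof -
  have cop: "coprime p d"
    using assms by (simp add: prime_imp_coprime)
  have "d \<noteq> 0"
    using assms by (intro notI) simp
  have "p \<noteq> 0"
    using assms by auto
  have sf: "squarefree (p * d) \<longleftrightarrow> squarefree d"
    using squarefree_mult_coprime[OF cop] squarefree_prime[of p] assms
      squarefree_multD(2)[of p d] by (auto simp: prime_elem_nat_iff)
  have "prime_factors (p * d) = insert p (prime_factors d)"
    using assms \<open>d \<noteq> 0\<close> \<open>p \<noteq> 0\<close> by (simp add: prime_factors_product prime_prime_factors)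
  moreover have "p \<notin> prime_factors d"
    using assms by auto
  ultimately show ?thesis
    by (simp add: moebius_mu_def sf)
qed

text \<open>For \<open>D\<close> other than 1, fix a prime \<open>p\<close> dividing
  \<open>D\<close>. Toggling the factor \<open>p\<close> is an involution on the squarefree divisors
  that reverses the sign of the summand, so the sum equals its own negative.\<close>

lemma sum_moebius_mu_divisors:
  assumes "D > 0"
  shows "(\<Sum>d | d dvd D. moebius_mu d) = of_bool (D = 1)"
proof (cases "D = 1")
  case True
  then show ?thesis
    by (simp add: moebius_mu_def)
next
  case False
  then obtain p where p: "prime p" "p dvd D"
    using prime_factor_nat by blast
  have fin: "finite {d. d dvd D}"
    using assms by simp
  have "p \<noteq> 0"
    using p(1) by auto
  let ?S = "{d. d dvd D \<and> squarefree d}"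
  define \<phi> where "\<phi> d = (if p dvd d then d div p else p * d)" for d
  have flip: "\<phi> d \<in> ?S \<and> \<phi> (\<phi> d) = d \<and> moebius_mu (\<phi> d) = - moebius_mu d"
    if d: "d \<in> ?S" for d
  proof (cases "p dvd d")
    case True
    then obtain e where e: "d = p * e" by blast
    \<comment> \<open>Squarefreeness of \<open>d\<close> ensures that one division by
      \<open>p\<close> removes this prime completely, so that applying \<open>\<phi>\<close> again
      multiplies it back.\<close>
    have "\<not> p dvd e"
    proof
      assume "p dvd e"
      then have "p ^ 2 dvd d"
        using e by (auto simp: power2_eq_square)
      then show False
        using d p(1) by (auto simp: squarefree_def)
    qed
    moreover have "squarefree e" "e dvd D"
      using d e squarefree_multD(2) dvd_mult_right by blast+
    ultimately show ?thesis
      using e \<open>p \<noteq> 0\<close> moebius_mu_prime_mult[OF p(1), of e] by (simp add: \<phi>_def)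
  next
    case False
    then have cop: "coprime p d"
      using p(1) by (simp add: prime_imp_coprime)
    have "p * d dvd D"
      using cop p(2) d by (simp add: divides_mult)
    moreover have "squarefree (p * d)"
      using cop d p(1) by (simp add: squarefree_mult_coprime squarefree_prime)
    ultimately show ?thesis
      using False \<open>p \<noteq> 0\<close> moebius_mu_prime_mult[OF p(1) False] by (simp add: \<phi>_def)
  qed
  have "(\<Sum>d\<in>?S. moebius_mu d) = (\<Sum>d\<in>?S. - moebius_mu d)"
    by (rule sum.reindex_bij_witness[of _ \<phi> \<phi>]) (use flip in auto)
  then have "(\<Sum>d\<in>?S. moebius_mu d) = 0"
    by (simp add: sum_negf)
  moreover have "(\<Sum>d | d dvd D. moebius_mu d) = (\<Sum>d\<in>?S. moebius_mu d)"
    by (rule sum.mono_neutral_right) (use fin in \<open>auto simp: moebius_mu_def\<close>)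
  ultimately show ?thesis
    using False by simp
qed

section \<open>Periods of sequences\<close>

text \<open>The value type is arbitrary so that \<open>f\<close> may be a sequence of whole rows.
  The number 0 counts as a period, which makes the periods closed under gcd and multiples without
  side conditions.\<close>

definition is_period :: "(nat \<Rightarrow> 'b) \<Rightarrow> nat \<Rightarrow> bool" where
  "is_period f p \<longleftrightarrow> (\<forall>i. f (i + p) = f i)"

lemma is_period_mult:
  assumes "is_period f p"
  shows "is_period f (p * x)"
proof (induction x)
  case 0
  show ?case by (simp add: is_period_def)
next
  case (Suc x)
  have "f (i + p * Suc x) = f (i + p * x)" for i
    using assms[unfolded is_period_def, rule_format, of "i + p * x"] by (simp add: ac_simps)
  with Suc show ?case by (simp add: is_period_def)
qed

lemma is_period_mod:
  assumes "is_period f p"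
  shows "f (i mod p) = f i"
  using is_period_mult[OF assms, of "i div p"]
  by (metis is_period_def mod_mult_div_eq)

lemma is_period_gcd:
  assumes "is_period f a" "is_period f b"
  shows "is_period f (gcd a b)"
proof (cases "a = 0")
  case True
  then show ?thesis using assms by simp
next
  case False
  \<comment> \<open>Bezout without subtraction: a shift by the gcd followed by a shift by
    \<open>b * y\<close> is a shift by \<open>a * x\<close>.\<close>
  then obtain x y where xy: "a * x = b * y + gcd a b"
    using bezout_nat by blast
  have "f (i + gcd a b) = f i" for i
  proof -
    have "f (i + gcd a b) = f (i + gcd a b + b * y)"
      using is_period_mult[OF assms(2), of y] by (simp add: is_period_def)
    also have "\<dots> = f (i + a * x)"
      by (simp add: xy ac_simps)
    also have "\<dots> = f i"
      using is_period_mult[OF assms(1), of x] by (simp add: is_period_def)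
    finally show ?thesis .
  qed
  then show ?thesis by (simp add: is_period_def)
qed

text \<open>The generator \<open>c\<close> is the least positive period, which exists because
  \<open>m\<close> is one. Its gcd with any period is again a positive period, hence not smaller
  than \<open>c\<close>, so \<open>c\<close> divides that period.\<close>

lemma periods_eq_multiples:
  assumes "m > 0" "is_period f m"
  obtains c where "c > 0" "\<And>p. is_period f p \<longleftrightarrow> c dvd p"
proof
  let ?P = "\<lambda>p. p > 0 \<and> is_period f p"
  let ?c = "LEAST p. ?P p"
  have c: "?P ?c"
    by (rule LeastI[of ?P m]) (use assms in simp)
  then show "?c > 0" by simp
  show "is_period f p \<longleftrightarrow> ?c dvd p" for p
  proof
    assume "is_period f p"
    then have "?P (gcd ?c p)"
      using c is_period_gcd[of f ?c p] by simp
    then have "?c \<le> gcd ?c p"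
      by (rule Least_le)
    then have "gcd ?c p = ?c"
      using c gcd_le1_nat[of ?c p] by linarith
    then show "?c dvd p"
      by (metis gcd_dvd2)
  next
    assume "?c dvd p"
    then show "is_period f p"
      using c is_period_mult by (metis dvdE)
  qed
qed

text \<open>With \<open>c\<close> the generator of the periods and \<open>m = c * D\<close>, the
  quotient \<open>m div d\<close> is a period exactly when \<open>d\<close> divides
  \<open>D\<close>. The indicator therefore cuts the sum down to the divisors of
  \<open>D\<close>.\<close>

lemma sum_moebius_mu_periods:
  assumes "m > 0" "is_period f m"
  shows "(\<Sum>d | d dvd m. moebius_mu d * of_bool (is_period f (m div d))) =
    of_bool (\<forall>d. d dvd m \<and> is_period f (m div d) \<longrightarrow> d = 1)"
proof -
  obtain c where c: "c > 0" "\<And>p. is_period f p \<longleftrightarrow> c dvd p"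
    using periods_eq_multiples[OF assms] by blast
  then obtain D where D: "m = c * D"
    using assms(2) by blast
  have "D > 0"
    using D assms(1) by (intro gr0I) simp
  have iff: "d dvd m \<and> is_period f (m div d) \<longleftrightarrow> d dvd D" for d
  proof
    assume d: "d dvd m \<and> is_period f (m div d)"
    then obtain e where "m div d = c * e"
      using c(2) by blast
    then have "c * D = c * (d * e)"
      using d D by (metis dvd_mult_div_cancel mult.left_commute)
    then show "d dvd D"
      using c(1) by simp
  next
    assume "d dvd D"
    then show "d dvd m \<and> is_period f (m div d)"
      using c(2) by (simp add: D div_mult_swap[symmetric])
  qed
  have "(\<Sum>d | d dvd m. moebius_mu d * of_bool (is_period f (m div d))) =
      (\<Sum>d | d dvd D. moebius_mu d)"
  proof (rule sum.mono_neutral_cong_right)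
    show "finite {d. d dvd m}" using assms(1) by simp
    show "{d. d dvd D} \<subseteq> {d. d dvd m}" using iff by auto
    show "\<forall>d\<in>{d. d dvd m} - {d. d dvd D}.
        moebius_mu d * of_bool (is_period f (m div d)) = 0"
      using iff by auto
    show "moebius_mu d * of_bool (is_period f (m div d)) = moebius_mu d"
      if "d \<in> {d. d dvd D}" for d
      using iff[of d] that by simp
  qed
  also have "\<dots> = of_bool (D = 1)"
    using \<open>D > 0\<close> by (rule sum_moebius_mu_divisors)
  also have "D = 1 \<longleftrightarrow> (\<forall>d. d dvd m \<and> is_period f (m div d) \<longrightarrow> d = 1)"
    by (auto simp: iff)
  finally show ?thesis .
qed

section \<open>Arrays\<close>

text \<open>Currying makes \<open>ext_rows M i\<close> an entire row, so one period of this
  function-valued sequence is a vertical period valid in all columns at once.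
  \<open>ext_cols\<close> swaps the arguments to treat horizontal periods alike.\<close>

definition ext_rows :: "'a mat \<Rightarrow> nat \<Rightarrow> nat \<Rightarrow> 'a" where
  "ext_rows M i j = M $$ (i mod dim_row M, j mod dim_col M)"

definition ext_cols :: "'a mat \<Rightarrow> nat \<Rightarrow> nat \<Rightarrow> 'a" where
  "ext_cols M j i = ext_rows M i j"

lemma is_period_ext_rows: "is_period (ext_rows M) (dim_row M)"
  by (simp add: is_period_def ext_rows_def fun_eq_iff)

lemma is_period_ext_cols: "is_period (ext_cols M) (dim_col M)"
  by (simp add: is_period_def ext_cols_def ext_rows_def fun_eq_iff)

section \<open>Array powers in terms of periods\<close>

lemma array_power_carrier:
  assumes "A \<in> carrier_mat r c"
  shows "array_power A p q \<in> carrier_mat (p * r) (q * c)"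
  using assms by (intro carrier_matI) (simp_all add: array_power_def)

lemma index_array_power:
  assumes "A \<in> carrier_mat r c" "i < p * r" "j < q * c"
  shows "array_power A p q $$ (i, j) = A $$ (i mod r, j mod c)"
  using assms by (simp add: array_power_def)

text \<open>Since \<open>r\<close> divides \<open>p * r\<close> and \<open>c\<close> divides
  \<open>q * c\<close>, reducing first modulo the dimensions of the power changes nothing.
  Positivity keeps the reduced indices inside the array.\<close>

lemma ext_rows_array_power:
  assumes "A \<in> carrier_mat r c" "p * r > 0" "q * c > 0"
  shows "ext_rows (array_power A p q) i j = A $$ (i mod r, j mod c)"
  using assms array_power_carrier[OF assms(1), of p q]
  by (simp add: ext_rows_def index_array_power[OF assms(1)] mod_mod_cancel)

lemma array_power_iff_periods:
  assumes M: "M \<in> carrier_mat m n" and "m > 0" "n > 0" and pq: "p dvd m" "q dvd n"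
  shows "(\<exists>A \<in> carrier_mat (m div p) (n div q). M = array_power A p q) \<longleftrightarrow>
    is_period (ext_rows M) (m div p) \<and> is_period (ext_cols M) (n div q)"
    (is "?L \<longleftrightarrow> ?R")
proof
  assume ?L
  then obtain A where A: "A \<in> carrier_mat (m div p) (n div q)" "M = array_power A p q"
    by blast
  have "ext_rows M i j = A $$ (i mod (m div p), j mod (n div q))" for i j
    unfolding A(2) by (rule ext_rows_array_power[OF A(1)]) (use assms in simp_all)
  then show ?R
    by (simp add: is_period_def ext_cols_def fun_eq_iff)
next
  assume R: ?R
  let ?r = "m div p" and ?c = "n div q"
  \<comment> \<open>The root can only be the top left block of \<open>M\<close>.\<close>
  let ?A = "mat ?r ?c (\<lambda>(i, j). M $$ (i, j))"
  have r: "?r > 0" "?r \<le> m" and c: "?c > 0" "?c \<le> n"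
    using assms by (auto simp: dvd_div_eq_0_iff intro: gr0I)
  have A: "?A \<in> carrier_mat ?r ?c"
    by simp
  have "M = array_power ?A p q"
  proof (rule eq_matI)
    fix i j
    assume "i < dim_row (array_power ?A p q)" "j < dim_col (array_power ?A p q)"
    then have ij: "i < m" "j < n"
      using pq by (simp_all add: array_power_def)
    have mod: "i mod ?r < ?r" "j mod ?c < ?c"
      using r c by simp_all
    have "M $$ (i, j) = ext_rows M i j"
      using M ij by (simp add: ext_rows_def)
    also have "\<dots> = ext_rows M (i mod ?r) j"
      using R is_period_mod[of "ext_rows M" ?r i] by simp
    also have "\<dots> = ext_rows M (i mod ?r) (j mod ?c)"
      using R is_period_mod[of "ext_cols M" ?c j] by (metis ext_cols_def)
    also have "\<dots> = M $$ (i mod ?r, j mod ?c)"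
    proof -
      have "i mod ?r < m" "j mod ?c < n"
        using mod r c by linarith+
      then show ?thesis using M by (simp add: ext_rows_def)
    qed
    also have "\<dots> = ?A $$ (i mod ?r, j mod ?c)"
      using mod by simp
    also have "\<dots> = array_power ?A p q $$ (i, j)"
      by (rule index_array_power[OF A, symmetric]) (use ij pq in simp_all)
    finally show "M $$ (i, j) = array_power ?A p q $$ (i, j)" .
  qed (use M pq in \<open>simp_all add: array_power_def\<close>)
  with A show ?L by blast
qed

lemma primitive_array_iff_periods:
  assumes M: "M \<in> carrier_mat m n" and "m > 0" "n > 0"
  shows "primitive_array M \<longleftrightarrow>
    (\<forall>d. d dvd m \<and> is_period (ext_rows M) (m div d) \<longrightarrow> d = 1) \<and>
    (\<forall>d. d dvd n \<and> is_period (ext_cols M) (n div d) \<longrightarrow> d = 1)"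
    (is "_ \<longleftrightarrow> ?R \<and> ?C")
proof
  assume prim: "primitive_array M"
  have *: "p = 1 \<and> q = 1"
    if per: "p dvd m" "q dvd n" "is_period (ext_rows M) (m div p)" "is_period (ext_cols M) (n div q)"
    for p q
  proof -
    obtain A where "M = array_power A p q"
      using array_power_iff_periods[OF assms per(1,2)] per(3,4) by blast
    moreover have "p > 0" "q > 0"
      using per(1,2) assms(2,3) by (auto intro: gr0I)
    ultimately show ?thesis
      using prim unfolding primitive_array_def by blast
  qed
  \<comment> \<open>The dimensions themselves are always periods, so \<open>*\<close> with
    \<open>q = 1\<close> or \<open>p = 1\<close> separates the conditions on rows and
    columns.\<close>
  have "is_period (ext_rows M) (m div 1)" "is_period (ext_cols M) (n div 1)"
    using is_period_ext_rows[of M] is_period_ext_cols[of M] M by simp_all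
  then show "?R \<and> ?C"
    using * one_dvd by blast
next
  assume RC: "?R \<and> ?C"
  have "p = 1 \<and> q = 1" if "p > 0" "q > 0" "M = array_power A p q" for A p q
  proof -
    have A: "A \<in> carrier_mat (dim_row A) (dim_col A)"
      by simp
    \<comment> \<open>Comparing dimensions shows that the exponents divide \<open>m\<close> and
      \<open>n\<close>, and that \<open>A\<close> has the size demanded by the period
      criterion.\<close>
    have dims: "m = p * dim_row A" "n = q * dim_col A"
      using that(3) M array_power_carrier[OF A, of p q] by auto
    then have "p dvd m" "q dvd n" "A \<in> carrier_mat (m div p) (n div q)"
      using that(1,2) by simp_all
    then show ?thesis
      using array_power_iff_periods[OF assms, of p q] that(3) RC by blast
  qed
  then show "primitive_array M"
    using assms by (auto simp: primitive_array_def)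
qed

section \<open>Counting arrays over a finite alphabet\<close>

lemma elements_mat_subset_iff:
  assumes "A \<in> carrier_mat r c"
  shows "elements_mat A \<subseteq> S \<longleftrightarrow> (\<forall>i<r. \<forall>j<c. A $$ (i, j) \<in> S)"
  using assms by fastforce

text \<open>\<open>mat r c\<close> ignores function values outside the index range; the extensional
  function space fixes them, which yields injectivity. Finiteness and cardinality then carry over
  from \<open>PiE\<close>.\<close>

lemma bij_betw_mat_PiE:
  "bij_betw (mat r c) (({..<r} \<times> {..<c}) \<rightarrow>\<^sub>E S) {A \<in> carrier_mat r c. elements_mat A \<subseteq> S}"
proof (rule bij_betw_byWitness[where f' = "\<lambda>A. restrict (($$) A) ({..<r} \<times> {..<c})"])
  show "\<forall>f\<in>({..<r} \<times> {..<c}) \<rightarrow>\<^sub>E S.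
      restrict (($$) (mat r c f)) ({..<r} \<times> {..<c}) = f"
    by (auto simp: fun_eq_iff restrict_def PiE_def extensional_def)
  show "\<forall>A\<in>{A \<in> carrier_mat r c. elements_mat A \<subseteq> S}.
      mat r c (restrict (($$) A) ({..<r} \<times> {..<c})) = A"
    by (auto intro!: eq_matI)
  show "mat r c ` (({..<r} \<times> {..<c}) \<rightarrow>\<^sub>E S) \<subseteq> {A \<in> carrier_mat r c. elements_mat A \<subseteq> S}"
    by (auto simp: elements_mat_subset_iff[of _ r c] PiE_def Pi_def)
  show "(\<lambda>A. restrict (($$) A) ({..<r} \<times> {..<c})) ` {A \<in> carrier_mat r c. elements_mat A \<subseteq> S}
      \<subseteq> ({..<r} \<times> {..<c}) \<rightarrow>\<^sub>E S"
    by (auto simp: elements_mat_subset_iff[of _ r c] split: if_splits)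
qed

lemma finite_arrays:
  assumes "finite S"
  shows "finite {A \<in> carrier_mat r c. elements_mat A \<subseteq> S}"
  using bij_betw_finite[OF bij_betw_mat_PiE[of r c S]] assms by (simp add: finite_PiE)

lemma card_arrays:
  "card {A \<in> carrier_mat r c. elements_mat A \<subseteq> S} = card S ^ (r * c)"
  using bij_betw_same_card[OF bij_betw_mat_PiE[of r c S]] by (simp add: card_PiE)

text \<open>Forming the power is a bijection from the \<open>m div p\<close> by
  \<open>n div q\<close> arrays over \<open>S\<close> onto the arrays counted here, because a power
  determines its root.\<close>

lemma card_arrays_with_periods:
  assumes "m > 0" "n > 0" and pq: "p dvd m" "q dvd n"
  shows "card {M \<in> carrier_mat m n. elements_mat M \<subseteq> S \<and>
      is_period (ext_rows M) (m div p) \<and> is_period (ext_cols M) (n div q)} =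
    card S ^ (m * n div (p * q))"
proof -
  let ?r = "m div p" and ?c = "n div q"
  let ?U = "{A \<in> carrier_mat ?r ?c. elements_mat A \<subseteq> S}"
  have r: "?r > 0" "?r \<le> m" and c: "?c > 0" "?c \<le> n"
    using assms by (auto simp: dvd_div_eq_0_iff intro: gr0I)
  have entry: "array_power A p q $$ (i, j) = A $$ (i mod ?r, j mod ?c)"
    if "A \<in> carrier_mat ?r ?c" "i < m" "j < n" for A :: "'a mat" and i j
    by (rule index_array_power[OF that(1)]) (use that pq in simp_all)
  have carrier: "array_power A p q \<in> carrier_mat m n"
    if "A \<in> carrier_mat ?r ?c" for A :: "'a mat"
    using array_power_carrier[OF that, of p q] pq by simp
  \<comment> \<open>The root reappears as the top left corner; this gives injectivity and shows that
    the root uses only letters of the power.\<close>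
  have corner: "array_power A p q $$ (i, j) = A $$ (i, j)"
    if "A \<in> carrier_mat ?r ?c" "i < ?r" "j < ?c" for A :: "'a mat" and i j
    using entry[OF that(1), of i j] that r c by simp
  have elems: "elements_mat (array_power A p q) \<subseteq> S \<longleftrightarrow> elements_mat A \<subseteq> S"
    if A: "A \<in> carrier_mat ?r ?c" for A :: "'a mat"
  proof
    assume "elements_mat (array_power A p q) \<subseteq> S"
    then have "array_power A p q $$ (i, j) \<in> S" if "i < ?r" "j < ?c" for i j
      using that r c less_le_trans unfolding elements_mat_subset_iff[OF carrier[OF A]] by blast
    then show "elements_mat A \<subseteq> S"
      by (auto simp: elements_mat_subset_iff[OF A] corner[OF A])
  next
    assume "elements_mat A \<subseteq> S"
    then show "elements_mat (array_power A p q) \<subseteq> S"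
      unfolding elements_mat_subset_iff[OF A] elements_mat_subset_iff[OF carrier[OF A]]
      using r c entry[OF A] by simp
  qed
  have "inj_on (\<lambda>A. array_power A p q) ?U"
  proof (rule inj_onI)
    fix A B
    assume AB: "A \<in> ?U" "B \<in> ?U" and eq: "array_power A p q = array_power B p q"
    show "A = B"
    proof (rule eq_matI)
      show "A $$ (i, j) = B $$ (i, j)" if "i < dim_row B" "j < dim_col B" for i j
        using corner[of A i j] corner[of B i j] eq AB that by auto
    qed (use AB in auto)
  qed
  moreover have "{M \<in> carrier_mat m n. elements_mat M \<subseteq> S \<and>
      is_period (ext_rows M) ?r \<and> is_period (ext_cols M) ?c} = (\<lambda>A. array_power A p q) ` ?U"
    (is "?P = _")
  proof (intro equalityI subsetI)
    fix M
    assume M: "M \<in> ?P"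
    then obtain A where "A \<in> carrier_mat ?r ?c" "M = array_power A p q"
      using array_power_iff_periods[OF _ assms, of M] by blast
    with M elems show "M \<in> (\<lambda>A. array_power A p q) ` ?U"
      by blast
  next
    fix M
    assume "M \<in> (\<lambda>A. array_power A p q) ` ?U"
    then obtain A where A: "A \<in> carrier_mat ?r ?c" "elements_mat A \<subseteq> S" "M = array_power A p q"
      by blast
    then show "M \<in> ?P"
      using array_power_iff_periods[OF carrier[OF A(1)] assms] elems[OF A(1)] carrier[OF A(1)]
      by blast
  qed
  ultimately have "card ?P = card ?U"
    by (simp add: card_image)
  also have "\<dots> = card S ^ (?r * ?c)"
    by (rule card_arrays)
  also have "?r * ?c = m * n div (p * q)"
    using pq by (simp add: div_mult_div_if_dvd)
  finally show ?thesis .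
qed

theorem theorem12:
  fixes k m n :: nat and \<Sigma> :: "'a set"
  assumes "k > 0" and "m > 0" and "n > 0"
    and "finite \<Sigma>" and "card \<Sigma> = k"
  shows "int (card {M \<in> carrier_mat m n. elements_mat M \<subseteq> \<Sigma> \<and> primitive_array M}) =
    (\<Sum>d1 | d1 dvd m. \<Sum>d2 | d2 dvd n.
       moebius_mu d1 * moebius_mu d2 * int k ^ (m * n div (d1 * d2)))"
proof -
  let ?U = "{M \<in> carrier_mat m n. elements_mat M \<subseteq> \<Sigma>}"
  let ?R = "\<lambda>M d. is_period (ext_rows M) (m div d)"
  let ?C = "\<lambda>M d. is_period (ext_cols M) (n div d)"
  have fin: "finite ?U"
    using assms(4) by (rule finite_arrays)
  \<comment> \<open>Cardinalities become sums of indicators: read forwards for the primitive arrays,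
    and backwards after the exchange for the arrays with prescribed periods.\<close>
  have count: "int (card {M \<in> carrier_mat m n. elements_mat M \<subseteq> \<Sigma> \<and> Q M}) =
      (\<Sum>M\<in>?U. of_bool (Q M))" for Q
  proof -
    have "{M \<in> carrier_mat m n. elements_mat M \<subseteq> \<Sigma> \<and> Q M} = ?U \<inter> {M. Q M}"
      by blast
    then show ?thesis
      using fin by (simp add: sum_of_bool_eq)
  qed
  have prim: "of_bool (primitive_array M) =
      (\<Sum>d1 | d1 dvd m. \<Sum>d2 | d2 dvd n.
        moebius_mu d1 * moebius_mu d2 * of_bool (?R M d1 \<and> ?C M d2))"
    if "M \<in> ?U" for M
  proof -
    have M: "M \<in> carrier_mat m n"
      using that by simp
    then have per: "is_period (ext_rows M) m" "is_period (ext_cols M) n"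
      using is_period_ext_rows[of M] is_period_ext_cols[of M] by simp_all
    \<comment> \<open>Each factor is the indicator that only the trivial exponent is possible in its
      direction, and a product of indicators is the indicator of the conjunction.\<close>
    have "of_bool (primitive_array M) =
        (\<Sum>d | d dvd m. moebius_mu d * of_bool (?R M d)) *
        (\<Sum>d | d dvd n. moebius_mu d * of_bool (?C M d))"
      unfolding primitive_array_iff_periods[OF M assms(2,3)] of_bool_conj
        sum_moebius_mu_periods[OF assms(2) per(1)] sum_moebius_mu_periods[OF assms(3) per(2)] ..
    then show ?thesis
      by (simp only: sum_product of_bool_conj mult.assoc mult.left_commute)
  qed
  have "int (card {M \<in> carrier_mat m n. elements_mat M \<subseteq> \<Sigma> \<and> primitive_array M}) =
      (\<Sum>M\<in>?U. \<Sum>d1 | d1 dvd m. \<Sum>d2 | d2 dvd n.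
        moebius_mu d1 * moebius_mu d2 * of_bool (?R M d1 \<and> ?C M d2))"
    unfolding count by (rule sum.cong[OF refl prim])
  \<comment> \<open>The sum over the arrays moves inwards past \<open>d1\<close> and then past
    \<open>d2\<close>.\<close>
  also have "\<dots> = (\<Sum>d1 | d1 dvd m. \<Sum>d2 | d2 dvd n. \<Sum>M\<in>?U.
        moebius_mu d1 * moebius_mu d2 * of_bool (?R M d1 \<and> ?C M d2))"
    by (subst sum.swap, rule sum.cong[OF refl], rule sum.swap)
  also have "\<dots> = (\<Sum>d1 | d1 dvd m. \<Sum>d2 | d2 dvd n.
       moebius_mu d1 * moebius_mu d2 * int k ^ (m * n div (d1 * d2)))"
  proof (intro sum.cong refl)
    fix d1 d2
    assume d: "d1 \<in> {d. d dvd m}" "d2 \<in> {d. d dvd n}"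
    have "(\<Sum>M\<in>?U. of_bool (?R M d1 \<and> ?C M d2)) = int k ^ (m * n div (d1 * d2))"
      using card_arrays_with_periods[OF assms(2,3), of d1 d2 \<Sigma>] d
      unfolding count[symmetric] assms(5) by simp
    then show "(\<Sum>M\<in>?U. moebius_mu d1 * moebius_mu d2 * of_bool (?R M d1 \<and> ?C M d2)) =
        moebius_mu d1 * moebius_mu d2 * int k ^ (m * n div (d1 * d2))"
      by (simp only: sum_distrib_left[symmetric])
  qed
  finally show ?thesis .
qed

end
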